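(* Let $\Gamma$ be a finitely generated discrete group with exponential growth, equipped with a word length function $\ell$, such that $\Gamma$ has the rapid decay property with some decay exponent $r>0$. Then $\mathrm{Mdim}_{L^k_\ell}(C^*_r(\Gamma))=+\infty$ for all natural numbers $k>r$.
   Context: $\ell$ is the word length function with respect to a fixed finite generating set. $\Gamma$ has the rapid decay property with decay exponent $r>0$ (with respect to $\ell$) if there is $C>0$ such that $\|f\|_{\mathrm{red}}\le C\big(\sum_{g\in\Gamma}|f(g)|^2(1+\ell(g))^{2r}\big)^{1/2}$ for all $f\in C_c(\Gamma)$. $C^*_r(\Gamma)$ is the reduced group $C^*$-algebra with norm $\|\cdot\|_{\mathrm{red}}$, $\lambda$ is its (left regular) representation on $\ell^2(\Gamma)$, and $C_c(\Gamma)$ is the dense $*$-subalgebra of finitely supported functions $\sum c_g\delta_g$ (with convolution product). $M_\ell$ is the unbounded operator on $\ell^2(\Gamma)$ with domain $C_c(\Gamma)$, $M_\ell(\sum c_g\delta_g)=\sum\ell(g)c_g\delta_g$. For $f\in C_c(\Gamma)$, $\Delta^1_\ell(f)=[M_\ell,\lambda(f)]$ and $\Delta^k_\ell(f)=[M_\ell,\Delta^{k-1}_\ell(f)]$; these extend to bounded operators. The seminorm $L^k_\ell:C^*_r(\Gamma)\to[0,+\infty]$ is $L^k_\ell(f)=\|\Delta^k_\ell(f)\|_{\mathrm{op}}$ for $f\in C_c(\Gamma)$ and $+\infty$ off $C_c(\Gamma)$. (For $k>r$ the pair $(C^*_r(\Gamma),L^k_\ell)$ is a compact quantum metric space, by a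 known theorem of Antonescu and Christensen; in particular $D(\mathcal L_1,\delta)$ below is finite.) For a subset $Y$ of a normed space $X$ and $\delta>0$, $D(Y,\delta)$ is the infimum of $\dim Z$ over finite-dimensional subspaces $Z\subseteq X$ such that for every $y\in Y$ there is $z\in Z$ with $\|y-z\|<\delta$. The metric dimension is $\mathrm{Mdim}_{L}(A)=\limsup_{\delta\to0^+}\frac{\log D(\mathcal L_1,\delta)}{\log\delta^{-1}}$, where $\mathcal L_1=\{a\in A:L(a)<1\}$. *)

theory Defs
  imports
    "HOL-Analysis.Infinite_Sum"
    "HOL-Algebra.Generated_Groups"
    "HOL-Library.Extended_Real"
    "HOL-Library.Extended_Nonnegative_Real"
    "HOL-Library.Function_Algebras"
    "HOL-Library.Liminf_Limsup"
begin

definition word_length :: "('g, 'm) monoid_scheme \<Rightarrow> 'g set \<Rightarrow> 'g \<Rightarrow> nat" where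
  "word_length G S g =
    (LEAST n. \<exists>ws. length ws = n \<and> set ws \<subseteq> S \<union> m_inv G ` S \<and>
       foldr (mult G) ws (one G) = g)"

definition growth :: "('g, 'm) monoid_scheme \<Rightarrow> 'g set \<Rightarrow> nat \<Rightarrow> nat" where
  "growth G S n = card {g \<in> carrier G. word_length G S g \<le> n}"

text \<open>The growth function is submultiplicative, so the limit superior below is a limit.  Whether
  it exceeds 1 does not depend on the finite generating set S.\<close>

definition exponential_growth :: "('g, 'm) monoid_scheme \<Rightarrow> 'g set \<Rightarrow> bool" where
  "exponential_growth G S \<longleftrightarrow> limsup (\<lambda>n. ereal (root n (real (growth G S n)))) > 1"

text \<open>Functions on the subset A of the type 'g are represented by functions on the
  whole type that vanish outside A.\<close>

definition ell2 :: "'g set \<Rightarrow> ('g \<Rightarrow> complex) set" where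
  "ell2 A = {\<xi>. (\<forall>x. x \<notin> A \<longrightarrow> \<xi> x = 0) \<and> (\<lambda>x. (cmod (\<xi> x))\<^sup>2) summable_on UNIV}"

definition norm2 :: "('g \<Rightarrow> complex) \<Rightarrow> real" where
  "norm2 \<xi> = sqrt (\<Sum>\<^sub>\<infinity>x. (cmod (\<xi> x))\<^sup>2)"

definition fin_supp :: "'g set \<Rightarrow> ('g \<Rightarrow> complex) set" where
  "fin_supp A = {f. (\<forall>x. x \<notin> A \<longrightarrow> f x = 0) \<and> finite {x. f x \<noteq> 0}}"

type_synonym 'g oper = "('g \<Rightarrow> complex) \<Rightarrow> ('g \<Rightarrow> complex)"

definition scale_oper :: "complex \<Rightarrow> 'g oper \<Rightarrow> 'g oper" where
  "scale_oper c T = (\<lambda>\<xi> x. c * T \<xi> x)"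

lemma vector_space_scale_oper: "vector_space scale_oper"
  by unfold_locales (auto simp: scale_oper_def fun_eq_iff algebra_simps)

text \<open>Operator norm of an operator with domain D.  For D dense in the Hilbert space and T
  bounded on D this is also the operator norm of the bounded extension of T.\<close>

definition op_norm :: "('g \<Rightarrow> complex) set \<Rightarrow> 'g oper \<Rightarrow> ennreal" where
  "op_norm D T = (SUP \<xi>\<in>{\<xi> \<in> D. norm2 \<xi> \<le> 1}. ennreal (norm2 (T \<xi>)))"

text \<open>The condition outside \<^term>\<open>ell2 A\<close> makes each bounded operator on \<^term>\<open>ell2 A\<close>
  correspond to exactly one element of the following set.\<close>

definition bounded_opers :: "'g set \<Rightarrow> 'g oper set" where
  "bounded_opers A = {T.
     (\<forall>\<xi>\<in>ell2 A. T \<xi> \<in> ell2 A) \<and>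
     (\<forall>\<xi>\<in>ell2 A. \<forall>\<eta>\<in>ell2 A. T (\<lambda>x. \<xi> x + \<eta> x) = (\<lambda>x. T \<xi> x + T \<eta> x)) \<and>
     (\<forall>c. \<forall>\<xi>\<in>ell2 A. T (\<lambda>x. c * \<xi> x) = (\<lambda>x. c * T \<xi> x)) \<and>
     (\<forall>\<xi>. \<xi> \<notin> ell2 A \<longrightarrow> T \<xi> = (\<lambda>x. 0)) \<and>
     op_norm (ell2 A) T < \<infinity>}"

definition convolution ::
    "('g, 'm) monoid_scheme \<Rightarrow> ('g \<Rightarrow> complex) \<Rightarrow> ('g \<Rightarrow> complex) \<Rightarrow> 'g \<Rightarrow> complex" where
  "convolution G f \<xi> x =
    (if x \<in> carrier G
     then \<Sum>g | f g \<noteq> 0. f g * \<xi> (mult G (m_inv G g) x)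
     else 0)"

definition left_reg :: "('g, 'm) monoid_scheme \<Rightarrow> ('g \<Rightarrow> complex) \<Rightarrow> 'g oper" where
  "left_reg G f = (\<lambda>\<xi>. if \<xi> \<in> ell2 (carrier G) then convolution G f \<xi> else (\<lambda>x. 0))"

definition reduced_norm :: "('g, 'm) monoid_scheme \<Rightarrow> 'g oper \<Rightarrow> ennreal" where
  "reduced_norm G = op_norm (ell2 (carrier G))"

definition reduced_algebra :: "('g, 'm) monoid_scheme \<Rightarrow> 'g oper set" where
  "reduced_algebra G = {T \<in> bounded_opers (carrier G).
     \<forall>\<epsilon>>0. \<exists>f\<in>fin_supp (carrier G). reduced_norm G (T - left_reg G f) < ennreal \<epsilon>}"

definition rapid_decay ::
    "('g, 'm) monoid_scheme \<Rightarrow> ('g \<Rightarrow> nat) \<Rightarrow> real \<Rightarrow> bool" where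
  "rapid_decay G l r \<longleftrightarrow>
    (\<exists>C>0. \<forall>f\<in>fin_supp (carrier G).
       reduced_norm G (left_reg G f) \<le>
         ennreal (C * sqrt (\<Sum>g | f g \<noteq> 0. (cmod (f g))\<^sup>2 * (1 + real (l g)) powr (2 * r))))"

text \<open>Only the values of these operators on finitely supported functions matter.\<close>

definition mult_length :: "('g \<Rightarrow> nat) \<Rightarrow> 'g oper" where
  "mult_length l \<xi> = (\<lambda>g. of_nat (l g) * \<xi> g)"

definition length_commutator :: "('g \<Rightarrow> nat) \<Rightarrow> 'g oper \<Rightarrow> 'g oper" where
  "length_commutator l T = (\<lambda>\<xi>. mult_length l (T \<xi>) - T (mult_length l \<xi>))"

definition length_seminorm ::
    "('g, 'm) monoid_scheme \<Rightarrow> ('g \<Rightarrow> nat) \<Rightarrow> nat \<Rightarrow> 'g oper \<Rightarrow> ennreal" where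
  "length_seminorm G l k T =
    (if T \<in> left_reg G ` fin_supp (carrier G)
     then op_norm (fin_supp (carrier G)) ((length_commutator l ^^ k) T)
     else \<infinity>)"

text \<open>Here X is a complex normed space inside the type 'v, with scalar multiplication smul and
  norm N, which is finite on X.\<close>

definition approx_dim ::
    "(complex \<Rightarrow> 'v \<Rightarrow> 'v) \<Rightarrow> ('v \<Rightarrow> ennreal) \<Rightarrow> 'v::ab_group_add set \<Rightarrow> 'v set \<Rightarrow> real \<Rightarrow> enat"
  where
  "approx_dim smul N X Y \<delta> =
    (INF Z\<in>{Z. Z \<subseteq> X \<and> (\<exists>B. finite B \<and> Z = module.span smul B) \<and>
               (\<forall>y\<in>Y. \<exists>z\<in>Z. N (y - z) < ennreal \<delta>)}.
       enat (vector_space.dim smul Z))"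

definition ln_enat :: "enat \<Rightarrow> ereal" where
  "ln_enat n = (case n of enat m \<Rightarrow> if m = 0 then - \<infinity> else ereal (ln (real m)) | \<infinity> \<Rightarrow> \<infinity>)"

definition metric_dim ::
    "(complex \<Rightarrow> 'v \<Rightarrow> 'v) \<Rightarrow> ('v \<Rightarrow> ennreal) \<Rightarrow> 'v::ab_group_add set \<Rightarrow> ('v \<Rightarrow> ennreal) \<Rightarrow> ereal"
  where
  "metric_dim smul N A L =
    Limsup (at_right 0)
      (\<lambda>\<delta>. ln_enat (approx_dim smul N A {a \<in> A. L a < 1} \<delta>) / ereal (ln (1 / \<delta>)))"

end

theory Submission
  imports Defs "HOL-Real_Asymp.Real_Asymp"
begin

text \<open>Let \<open>B\<^sub>n\<close> be the ball of radius \<open>n\<close>.  Rapid decay bounds the seminorm of a function \<open>f\<close> supported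
  in \<open>B\<^sub>n\<close> by \<open>C (1 + n)\<^bsup>k+r\<^esup>\<close> times its 2-norm, so the unit ball of the seminorm contains a
  Euclidean ball of radius \<open>R\<^sub>n\<close> in the functions on \<open>B\<^sub>n\<close>, where \<open>1 / R\<^sub>n\<close> is polynomial in \<open>n\<close>.  As
  the reduced norm dominates the 2-norm, approximating this Euclidean ball up to \<open>R\<^sub>n\<close> takes a
  subspace of dimension at least \<open>card B\<^sub>n\<close>, which is exponential in \<open>n\<close> for infinitely many \<open>n\<close>.\<close>

section \<open>Word length\<close>

locale generated_group = group G for G (structure) +
  fixes S
  assumes gen_subset: "S \<subseteq> carrier G" and generate_eq: "generate G S = carrier G"
begin

definition letters where
  "letters = S \<union> m_inv G ` S"

abbreviation word_value where
  "word_value ws \<equiv> foldr (mult G) ws \<one>"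

lemma letters_subset: "letters \<subseteq> carrier G"
  using gen_subset by (auto simp: letters_def)

lemma word_value_closed: "set ws \<subseteq> letters \<Longrightarrow> word_value ws \<in> carrier G"
  using letters_subset by (induction ws) auto

lemma word_value_append:
  "set us \<subseteq> letters \<Longrightarrow> set vs \<subseteq> letters \<Longrightarrow> word_value (us @ vs) = word_value us \<otimes> word_value vs"
  using letters_subset by (induction us) (auto simp: word_value_closed m_assoc subset_iff)

lemma inv_letters: "x \<in> letters \<Longrightarrow> inv x \<in> letters"
  using gen_subset by (auto simp: letters_def subset_iff)

lemma word_value_inv:
  assumes "set ws \<subseteq> letters"
  shows "word_value (rev (map (m_inv G) ws)) = inv (word_value ws)"
  using assms
proof (induction ws)
  case (Cons w ws)
  then have w: "w \<in> carrier G" "inv w \<in> letters" and ws: "set ws \<subseteq> letters"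
    using letters_subset inv_letters by auto
  have "set (rev (map (m_inv G) ws)) \<subseteq> letters"
    using ws inv_letters by auto
  then have "word_value (rev (map (m_inv G) (w # ws))) =
      word_value (rev (map (m_inv G) ws)) \<otimes> word_value [inv w]"
    using w by (simp only: rev.simps list.map) (subst word_value_append, auto)
  then show ?case
    using Cons.IH ws w word_value_closed[OF ws] by (simp add: inv_mult_group)
qed simp

lemma exists_word:
  assumes "g \<in> carrier G"
  shows "\<exists>ws. set ws \<subseteq> letters \<and> word_value ws = g"
proof -
  have "g \<in> generate G S"
    using assms generate_eq by simp
  then show ?thesis
  proof (induction rule: generate.induct)
    case one
    show ?case by (rule exI[of _ "[]"]) simp
  next
    case (incl h)
    then show ?case using gen_subset by (intro exI[of _ "[h]"]) (auto simp: letters_def)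
  next
    case (inv h)
    then show ?case using gen_subset by (intro exI[of _ "[m_inv G h]"]) (auto simp: letters_def)
  next
    case (eng h1 h2)
    then obtain us vs where "set us \<subseteq> letters" "word_value us = h1"
      "set vs \<subseteq> letters" "word_value vs = h2" by blast
    then show ?case
      by (intro exI[of _ "us @ vs"]) (auto simp: word_value_append simp del: foldr_append)
  qed
qed

lemma word_length_le: "set ws \<subseteq> letters \<Longrightarrow> word_length G S (word_value ws) \<le> length ws"
  unfolding word_length_def letters_def by (rule Least_le) blast

text \<open>\<open>LEAST\<close> has its intended value only if some word represents
  \<open>g\<close>; that is what generation by \<open>S\<close> provides, through
  \<open>exists_word\<close>.\<close>

lemma minimal_word:
  assumes "g \<in> carrier G"
  obtains ws where "set ws \<subseteq> letters" "word_value ws = g" "length ws = word_length G S g"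
proof -
  have "\<exists>n ws. length ws = n \<and> set ws \<subseteq> S \<union> m_inv G ` S \<and> word_value ws = g"
    using exists_word[OF assms] by (auto simp: letters_def)
  from LeastI_ex[OF this] show ?thesis
    using that by (auto simp: word_length_def letters_def)
qed

lemma word_length_mult:
  assumes "g \<in> carrier G" "h \<in> carrier G"
  shows "word_length G S (g \<otimes> h) \<le> word_length G S g + word_length G S h"
proof -
  obtain us where us: "set us \<subseteq> letters" "word_value us = g" "length us = word_length G S g"
    using minimal_word assms(1) by blast
  obtain vs where vs: "set vs \<subseteq> letters" "word_value vs = h" "length vs = word_length G S h"
    using minimal_word assms(2) by blast
  show ?thesis
    using word_length_le[of "us @ vs"] us vs by (simp add: word_value_append del: foldr_append)
qed

lemma word_length_inv:
  assumes "g \<in> carrier G"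
  shows "word_length G S (inv g) \<le> word_length G S g"
proof -
  obtain us where us: "set us \<subseteq> letters" "word_value us = g" "length us = word_length G S g"
    using minimal_word assms by blast
  then have "set (rev (map (m_inv G) us)) \<subseteq> letters"
    using inv_letters by auto
  from word_length_le[OF this] show ?thesis
    using us word_value_inv[OF us(1)] by simp
qed

text \<open>Two triangle inequalities, for x = g (g^-1 x) and for the product g^-1 x, the latter
  with l(g^-1) \<le> l(g). The bound is uniform in x, which is what controls the
  commutators.\<close>

lemma word_length_diff:
  assumes g: "g \<in> carrier G" and x: "x \<in> carrier G"
  shows "\<bar>real (word_length G S x) - real (word_length G S (inv g \<otimes> x))\<bar> \<le> real (word_length G S g)"
proof -
  have "g \<otimes> (inv g \<otimes> x) = x"
    using g x by (simp add: m_assoc[symmetric])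
  then show ?thesis
    using word_length_mult[of g "inv g \<otimes> x"] word_length_mult[of "inv g" x] word_length_inv[of g] g x
    by simp
qed

end

section \<open>Square-summable functions\<close>

lemma fin_suppI: "finite F \<Longrightarrow> F \<subseteq> A \<Longrightarrow> (\<And>x. x \<notin> F \<Longrightarrow> f x = 0) \<Longrightarrow> f \<in> fin_supp A"
  unfolding fin_supp_def by (auto intro: finite_subset[of _ F])

lemma fin_supp_subset_ell2: "fin_supp A \<subseteq> ell2 A"
proof
  fix f assume f: "f \<in> fin_supp A"
  then have "(\<lambda>x. (cmod (f x))\<^sup>2) summable_on {x. f x \<noteq> 0}"
    by (simp add: fin_supp_def)
  then have "(\<lambda>x. (cmod (f x))\<^sup>2) summable_on UNIV"
    by (rule summable_on_cong_neutral[THEN iffD1, rotated -1]) auto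
  then show "f \<in> ell2 A"
    using f by (auto simp: ell2_def fin_supp_def)
qed

text \<open>Comparison with 2|f|^2 + 2|g|^2, where the mixed term is absorbed by (|f| - |g|)^2 \<ge>
  0.\<close>

lemma ell2_diff_summable:
  assumes "f \<in> ell2 A" "g \<in> ell2 A"
  shows "(\<lambda>x. (cmod (f x - g x))\<^sup>2) summable_on UNIV"
proof (rule summable_on_comparison_test)
  show "(\<lambda>x. 2 * (cmod (f x))\<^sup>2 + 2 * (cmod (g x))\<^sup>2) summable_on UNIV"
    using assms by (intro summable_on_add summable_on_cmult_right) (auto simp: ell2_def)
  show "(cmod (f x - g x))\<^sup>2 \<le> 2 * (cmod (f x))\<^sup>2 + 2 * (cmod (g x))\<^sup>2" for x
  proof -
    have "(cmod (f x - g x))\<^sup>2 \<le> (cmod (f x) + cmod (g x))\<^sup>2"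
      by (intro power_mono norm_triangle_ineq4) auto
    also have "\<dots> \<le> 2 * (cmod (f x))\<^sup>2 + 2 * (cmod (g x))\<^sup>2"
      using zero_le_power2[of "cmod (f x) - cmod (g x)"] by (simp add: power2_eq_square algebra_simps)
    finally show ?thesis .
  qed
qed auto

lemma ell2_scale: "f \<in> ell2 A \<Longrightarrow> (\<lambda>x. c * f x) \<in> ell2 A"
  by (auto simp: ell2_def norm_mult power_mult_distrib intro: summable_on_cmult_right)

lemma ell2_add:
  assumes "f \<in> ell2 A" "g \<in> ell2 A"
  shows "(\<lambda>x. f x + g x) \<in> ell2 A"
  using ell2_diff_summable[OF assms(1) ell2_scale[OF assms(2), of "-1"]] assms
  by (auto simp: ell2_def)

lemma ell2_sum:
  assumes "finite I" "\<And>i. i \<in> I \<Longrightarrow> f i \<in> ell2 A"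
  shows "(\<lambda>x. \<Sum>i\<in>I. f i x) \<in> ell2 A"
  using assms by (induction I rule: finite_induct) (auto simp: ell2_add, simp add: ell2_def)

text \<open>An infinite sum that does not converge has the default value 0, so summability of the
  majorant must be secured; finite support of \<open>g\<close> does this, and comparison passes it
  on to \<open>f\<close>.\<close>

lemma norm2_mono:
  assumes "g \<in> fin_supp A" "\<And>x. cmod (f x) \<le> cmod (g x)"
  shows "norm2 f \<le> norm2 g"
proof -
  have g: "(\<lambda>x. (cmod (g x))\<^sup>2) summable_on UNIV"
    using assms(1) fin_supp_subset_ell2[of A] by (auto simp: ell2_def)
  moreover have "(\<lambda>x. (cmod (f x))\<^sup>2) summable_on UNIV"
    by (rule summable_on_comparison_test[OF g]) (use assms(2) in \<open>auto intro: power_mono\<close>)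
  ultimately show ?thesis
    unfolding norm2_def by (intro real_sqrt_le_mono infsum_mono) (use assms(2) in \<open>auto intro: power_mono\<close>)
qed

lemma op_norm_ge: "\<xi> \<in> D \<Longrightarrow> norm2 \<xi> \<le> 1 \<Longrightarrow> ennreal (norm2 (T \<xi>)) \<le> op_norm D T"
  unfolding op_norm_def by (rule SUP_upper) auto

section \<open>Iterated commutators\<close>

text \<open>Multiplication by l is diagonal, so each commutator multiplies the matrix entry at (x,
  y) by l(x) - l(y); here y = g^-1 x. It also preserves finite support, so \<open>left_reg\<close>
  never takes its default value outside \<open>ell2\<close>.\<close>

lemma length_commutator_power_apply:
  assumes "f \<in> fin_supp (carrier G)" "\<xi> \<in> fin_supp (carrier G)"
  shows "(length_commutator l ^^ k) (left_reg G f) \<xi> x =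
    (if x \<in> carrier G
     then \<Sum>g | f g \<noteq> 0. f g * (of_nat (l x) - of_nat (l (mult G (m_inv G g) x))) ^ k
       * \<xi> (mult G (m_inv G g) x)
     else 0)"
  using assms(2)
proof (induction k arbitrary: \<xi> x)
  case 0
  then show ?case
    using fin_supp_subset_ell2[of "carrier G"] by (auto simp: left_reg_def convolution_def)
next
  case (Suc k)
  have "mult_length l \<xi> \<in> fin_supp (carrier G)"
    by (rule fin_suppI[of "{x. \<xi> x \<noteq> 0}"]) (use Suc.prems in \<open>auto simp: fin_supp_def mult_length_def\<close>)
  then show ?case
    using Suc.IH[OF Suc.prems, of x] Suc.IH[of "mult_length l \<xi>" x]
    by (simp add: length_commutator_def mult_length_def sum_distrib_left sum_subtractf[symmetric])
      (auto intro!: sum.cong simp: algebra_simps)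
qed

section \<open>Convolution operators and the estimate of their seminorms\<close>

lemma (in group) convolution_fin_supp:
  assumes f: "f \<in> fin_supp (carrier G)" and \<xi>: "\<xi> \<in> fin_supp (carrier G)"
  shows "convolution G f \<xi> \<in> fin_supp (carrier G)"
proof (rule fin_suppI)
  \<comment> \<open>The product of the two supports contains the support of the convolution.\<close>
  let ?P = "(\<lambda>(g, h). g \<otimes> h) ` ({g. f g \<noteq> 0} \<times> {h. \<xi> h \<noteq> 0})"
  show "finite ?P"
    using f \<xi> by (simp add: fin_supp_def)
  show "?P \<subseteq> carrier G"
    using f \<xi> by (auto simp: fin_supp_def)
  fix x assume x: "x \<notin> ?P"
  have "\<xi> (inv g \<otimes> x) = 0" if "f g \<noteq> 0" "x \<in> carrier G" for g
  proof (rule ccontr)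
    assume "\<xi> (inv g \<otimes> x) \<noteq> 0"
    moreover have "g \<in> carrier G"
      using that f by (auto simp: fin_supp_def)
    then have "g \<otimes> (inv g \<otimes> x) = x"
      using that by (simp add: m_assoc[symmetric])
    ultimately show False
      using x that(1) by force
  qed
  then show "convolution G f \<xi> x = 0"
    by (auto simp: convolution_def intro!: sum.neutral)
qed

lemma (in group) translation_ell2:
  assumes g: "g \<in> carrier G" and \<xi>: "\<xi> \<in> ell2 (carrier G)"
  shows "(\<lambda>x. if x \<in> carrier G then \<xi> (inv g \<otimes> x) else 0) \<in> ell2 (carrier G)"
proof -
  \<comment> \<open>Left translation permutes the group, so it only reorders the sum of
    squares.\<close>
  have "bij_betw (\<lambda>x. inv g \<otimes> x) (carrier G) (carrier G)"
    by (rule bij_betw_byWitness[where f' = "\<lambda>x. g \<otimes> x"]) (use g in \<open>auto simp: m_assoc[symmetric]\<close>)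
  moreover have "(\<lambda>x. (cmod (\<xi> x))\<^sup>2) summable_on carrier G"
    using \<xi> by (auto simp: ell2_def intro: summable_on_subset_banach)
  ultimately have "(\<lambda>x. (cmod (\<xi> (inv g \<otimes> x)))\<^sup>2) summable_on carrier G"
    using summable_on_reindex_bij_betw by fastforce
  then have "(\<lambda>x. (cmod (if x \<in> carrier G then \<xi> (inv g \<otimes> x) else 0))\<^sup>2) summable_on UNIV"
    by (rule summable_on_cong_neutral[THEN iffD1, rotated -1]) auto
  then show ?thesis
    by (auto simp: ell2_def)
qed

text \<open>The convolution is a finite linear combination of left translates of \<xi>.\<close>

lemma (in group) convolution_ell2:
  assumes f: "f \<in> fin_supp (carrier G)" and \<xi>: "\<xi> \<in> ell2 (carrier G)"
  shows "convolution G f \<xi> \<in> ell2 (carrier G)"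
proof -
  have "convolution G f \<xi> =
      (\<lambda>x. \<Sum>g | f g \<noteq> 0. f g * (if x \<in> carrier G then \<xi> (inv g \<otimes> x) else 0))"
    by (auto simp: convolution_def)
  also have "\<dots> \<in> ell2 (carrier G)"
    using f by (intro ell2_sum ell2_scale translation_ell2 \<xi>) (auto simp: fin_supp_def)
  finally show ?thesis .
qed

text \<open>For every tolerance \<open>f\<close> serves as its own approximation. The finiteness
  assumption will be supplied by rapid decay.\<close>

lemma (in group) left_reg_reduced_algebra:
  assumes f: "f \<in> fin_supp (carrier G)" and bounded: "reduced_norm G (left_reg G f) < \<infinity>"
  shows "left_reg G f \<in> reduced_algebra G"
proof -
  have "left_reg G f \<in> bounded_opers (carrier G)"
    unfolding bounded_opers_def
  proof (intro CollectI conjI ballI allI impI)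
    show "left_reg G f \<xi> \<in> ell2 (carrier G)" if "\<xi> \<in> ell2 (carrier G)" for \<xi>
      using that f by (simp add: left_reg_def convolution_ell2)
    show "left_reg G f (\<lambda>x. \<xi> x + \<eta> x) = (\<lambda>x. left_reg G f \<xi> x + left_reg G f \<eta> x)"
      if "\<xi> \<in> ell2 (carrier G)" "\<eta> \<in> ell2 (carrier G)" for \<xi> \<eta>
      using that by (auto simp: left_reg_def convolution_def ell2_add fun_eq_iff sum.distrib algebra_simps)
    show "left_reg G f (\<lambda>x. c * \<xi> x) = (\<lambda>x. c * left_reg G f \<xi> x)"
      if "\<xi> \<in> ell2 (carrier G)" for c \<xi>
      using that by (auto simp: left_reg_def convolution_def ell2_scale fun_eq_iff sum_distrib_left algebra_simps)
    show "op_norm (ell2 (carrier G)) (left_reg G f) < \<infinity>"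
      using bounded by (simp add: reduced_norm_def)
  qed (simp add: left_reg_def)
  moreover have "reduced_norm G (left_reg G f - left_reg G f) = 0"
    unfolding reduced_norm_def op_norm_def
    by (intro antisym SUP_least) (auto simp: norm2_def)
  ultimately show ?thesis
    using f unfolding reduced_algebra_def by force
qed

text \<open>The matrix entries of the iterated commutator are \<open>f(x y\<^sup>-\<^sup>1) (l(x) - l(y))\<^sup>k\<close>, hence
  dominated by those of the convolution operator of \<open>\<bar>f\<bar> l\<^sup>k\<close>.\<close>

lemma (in generated_group) op_norm_length_commutator_le:
  assumes f: "f \<in> fin_supp (carrier G)"
  defines "l \<equiv> word_length G S"
  shows "op_norm (fin_supp (carrier G)) ((length_commutator l ^^ k) (left_reg G f))
    \<le> reduced_norm G (left_reg G (\<lambda>g. of_real (cmod (f g) * real (l g) ^ k)))"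
  unfolding op_norm_def
proof (rule SUP_least)
  let ?h = "\<lambda>g. complex_of_real (cmod (f g) * real (l g) ^ k)"
  fix \<xi> assume "\<xi> \<in> {\<xi> \<in> fin_supp (carrier G). norm2 \<xi> \<le> 1}"
  then have \<xi>: "\<xi> \<in> fin_supp (carrier G)" and \<xi>1: "norm2 \<xi> \<le> 1" by auto
  \<comment> \<open>Passing to absolute values keeps the 2-norm, so this is again a vector of norm
    at most 1, and all terms of its convolution with \<open>?h\<close> are nonnegative.\<close>
  let ?\<eta> = "\<lambda>x. complex_of_real (cmod (\<xi> x))"
  have \<eta>: "?\<eta> \<in> fin_supp (carrier G)"
    using \<xi> by (auto simp: fin_supp_def)
  have h: "?h \<in> fin_supp (carrier G)"
    by (rule fin_suppI[of "{x. f x \<noteq> 0}"]) (use f in \<open>auto simp: fin_supp_def\<close>)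
  have \<eta>2: "?\<eta> \<in> ell2 (carrier G)"
    using \<eta> fin_supp_subset_ell2 by blast
  have dom: "cmod ((length_commutator l ^^ k) (left_reg G f) \<xi> x) \<le> cmod (convolution G ?h ?\<eta> x)" for x
  proof (cases "x \<in> carrier G")
    case True
    have "cmod ((length_commutator l ^^ k) (left_reg G f) \<xi> x) =
      cmod (\<Sum>g | f g \<noteq> 0. f g * (of_nat (l x) - of_nat (l (inv g \<otimes> x))) ^ k * \<xi> (inv g \<otimes> x))"
      using True by (simp add: length_commutator_power_apply[OF f \<xi>])
    also have "\<dots> \<le> (\<Sum>g | f g \<noteq> 0. cmod (f g) * real (l g) ^ k * cmod (\<xi> (inv g \<otimes> x)))"
    proof (rule sum_norm_le)
      fix g assume "g \<in> {g. f g \<noteq> 0}"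
      then have g: "g \<in> carrier G"
        using f by (auto simp: fin_supp_def)
      have "cmod (of_nat (l x) - of_nat (l (inv g \<otimes> x))) = \<bar>real (l x) - real (l (inv g \<otimes> x))\<bar>"
        by (metis norm_of_real of_real_diff of_real_of_nat_eq)
      also have "\<dots> \<le> real (l g)"
        using word_length_diff[OF g True] by (simp add: l_def)
      finally show "cmod (f g * (of_nat (l x) - of_nat (l (inv g \<otimes> x))) ^ k * \<xi> (inv g \<otimes> x))
          \<le> cmod (f g) * real (l g) ^ k * cmod (\<xi> (inv g \<otimes> x))"
        by (simp add: norm_mult norm_power) (intro mult_right_mono mult_left_mono power_mono, auto)
    qed
    also have "\<dots> = cmod (\<Sum>g | f g \<noteq> 0. ?h g * ?\<eta> (inv g \<otimes> x))"
    proof -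
      have "(\<Sum>g | f g \<noteq> 0. ?h g * ?\<eta> (inv g \<otimes> x)) =
        of_real (\<Sum>g | f g \<noteq> 0. cmod (f g) * real (l g) ^ k * cmod (\<xi> (inv g \<otimes> x)))"
        by simp
      then show ?thesis
        by (simp only: norm_of_real) (intro abs_of_nonneg[symmetric] sum_nonneg, auto)
    qed
    \<comment> \<open>The support of \<open>?h\<close> can be smaller than that of \<open>f\<close>:
      for k > 0 the factor l(g)^k vanishes at the identity.\<close>
    also have "(\<Sum>g | f g \<noteq> 0. ?h g * ?\<eta> (inv g \<otimes> x)) = (\<Sum>g | ?h g \<noteq> 0. ?h g * ?\<eta> (inv g \<otimes> x))"
      by (rule sum.mono_neutral_right) (use f in \<open>auto simp: fin_supp_def\<close>)
    finally show ?thesis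
      using True by (simp add: convolution_def)
  qed (simp add: length_commutator_power_apply[OF f \<xi>])
  have "ennreal (norm2 ((length_commutator l ^^ k) (left_reg G f) \<xi>)) \<le> ennreal (norm2 (left_reg G ?h ?\<eta>))"
    using norm2_mono[OF convolution_fin_supp[OF h \<eta>] dom] \<eta>2 by (simp add: left_reg_def ennreal_leI)
  also have "\<dots> \<le> reduced_norm G (left_reg G ?h)"
    unfolding reduced_norm_def by (rule op_norm_ge[OF \<eta>2]) (use \<xi>1 in \<open>simp add: norm2_def\<close>)
  finally show "ennreal (norm2 ((length_commutator l ^^ k) (left_reg G f) \<xi>))
    \<le> reduced_norm G (left_reg G ?h)" .
qed

text \<open>Rapid decay is applied to the majorant |f| l^k. Its weight l^(2k) (1 + l)^(2r) is at
  most (1 + n)^(2(k+r)) on the ball of radius n.\<close>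

lemma (in generated_group) length_seminorm_le:
  assumes f: "f \<in> fin_supp (carrier G)"
    and supp: "\<And>g. f g \<noteq> 0 \<Longrightarrow> word_length G S g \<le> n"
    and norm: "(\<Sum>g | f g \<noteq> 0. (cmod (f g))\<^sup>2) \<le> R\<^sup>2" and "R \<ge> 0" "C \<ge> 0" "r \<ge> 0"
    and RD: "\<And>f. f \<in> fin_supp (carrier G) \<Longrightarrow> reduced_norm G (left_reg G f) \<le>
         ennreal (C * sqrt (\<Sum>g | f g \<noteq> 0. (cmod (f g))\<^sup>2 * (1 + real (word_length G S g)) powr (2 * r)))"
  shows "length_seminorm G (word_length G S) k (left_reg G f)
    \<le> ennreal (C * ((1 + real n) powr (real k + r) * R))"
proof -
  let ?l = "word_length G S"
  let ?h = "\<lambda>g. complex_of_real (cmod (f g) * real (?l g) ^ k)"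
  have fin: "finite {g. f g \<noteq> 0}"
    using f by (simp add: fin_supp_def)
  have h: "?h \<in> fin_supp (carrier G)"
    by (rule fin_suppI[of "{x. f x \<noteq> 0}"]) (use f in \<open>auto simp: fin_supp_def\<close>)
  have "(\<Sum>g | ?h g \<noteq> 0. (cmod (?h g))\<^sup>2 * (1 + real (?l g)) powr (2 * r))
      = (\<Sum>g | f g \<noteq> 0. (cmod (?h g))\<^sup>2 * (1 + real (?l g)) powr (2 * r))"
    by (rule sum.mono_neutral_left) (use fin in auto)
  also have "\<dots> \<le> (\<Sum>g | f g \<noteq> 0. (cmod (f g))\<^sup>2 * ((1 + real n) powr (real k + r))\<^sup>2)"
  proof (rule sum_mono)
    fix g assume "g \<in> {g. f g \<noteq> 0}"
    then have g: "?l g \<le> n" using supp by simp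
    have "(real (?l g) ^ k)\<^sup>2 * (1 + real (?l g)) powr (2 * r)
        \<le> ((1 + real n) ^ k)\<^sup>2 * (1 + real n) powr (2 * r)"
      using g \<open>r \<ge> 0\<close> by (intro mult_mono power_mono powr_mono2) auto
    also have "\<dots> = ((1 + real n) powr (real k + r))\<^sup>2"
      by (simp add: powr_add powr_realpow[symmetric] power2_eq_square flip: powr_add)
    finally show "(cmod (?h g))\<^sup>2 * (1 + real (?l g)) powr (2 * r)
        \<le> (cmod (f g))\<^sup>2 * ((1 + real n) powr (real k + r))\<^sup>2"
      by (simp add: norm_mult norm_power power_mult_distrib mult.assoc mult_left_mono)
  qed
  also have "\<dots> \<le> R\<^sup>2 * ((1 + real n) powr (real k + r))\<^sup>2"
    unfolding sum_distrib_right[symmetric] by (rule mult_right_mono[OF norm]) simp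
  also have "\<dots> = ((1 + real n) powr (real k + r) * R)\<^sup>2"
    by (simp add: power_mult_distrib mult.commute)
  finally have bound: "sqrt (\<Sum>g | ?h g \<noteq> 0. (cmod (?h g))\<^sup>2 * (1 + real (?l g)) powr (2 * r))
      \<le> (1 + real n) powr (real k + r) * R"
    using \<open>R \<ge> 0\<close> by (intro real_le_lsqrt) (auto intro: sum_nonneg)
  have "length_seminorm G ?l k (left_reg G f) \<le> reduced_norm G (left_reg G ?h)"
    using f op_norm_length_commutator_le[OF f] by (simp add: length_seminorm_def)
  also have "\<dots> \<le> ennreal (C * sqrt (\<Sum>g | ?h g \<noteq> 0. (cmod (?h g))\<^sup>2 * (1 + real (?l g)) powr (2 * r)))"
    by (rule RD[OF h])
  also have "\<dots> \<le> ennreal (C * ((1 + real n) powr (real k + r) * R))"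
    by (intro ennreal_leI mult_left_mono bound \<open>C \<ge> 0\<close>)
  finally show ?thesis .
qed

section \<open>Approximation by subspaces\<close>

text \<open>Gaussian elimination, by induction on the equations. Later the equations are indexed by
  operators and the unknowns by group elements.\<close>

lemma exists_nontrivial_solution:
  fixes a :: "'i \<Rightarrow> 'j \<Rightarrow> 'a::field"
  assumes "finite I" "finite J" "card I < card J"
  shows "\<exists>x. (\<exists>j\<in>J. x j \<noteq> 0) \<and> (\<forall>i\<in>I. (\<Sum>j\<in>J. a i j * x j) = 0)"
  using assms
proof (induction I arbitrary: J a rule: finite_induct)
  case empty
  then have "J \<noteq> {}" by auto
  then show ?case by (intro exI[of _ "\<lambda>_. 1"]) auto
next
  case (insert i I)
  show ?case
  proof (cases "\<forall>j\<in>J. a i j = 0")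
    case True
    then show ?thesis
      using insert.IH[of J a] insert.prems insert.hyps by auto
  next
    case False
    then obtain p where p: "p \<in> J" "a i p \<noteq> 0" by auto
    \<comment> \<open>Equation \<open>i\<close> is used to eliminate the unknown \<open>p\<close>;
      \<open>?b\<close> is the matrix of the remaining system.\<close>
    let ?J = "J - {p}" and ?b = "\<lambda>i' j. a i' j - a i' p * a i j / a i p"
    have "card I < card ?J"
      using insert.prems insert.hyps p by simp
    then obtain y where y: "\<exists>j\<in>?J. y j \<noteq> 0" "\<And>i'. i' \<in> I \<Longrightarrow> (\<Sum>j\<in>?J. ?b i' j * y j) = 0"
      using insert.IH[of ?J ?b] insert.prems by blast
    \<comment> \<open>The value of the unknown \<open>p\<close> that equation \<open>i\<close>
      forces.\<close>
    define t where "t = - (\<Sum>j\<in>?J. a i j * y j) / a i p"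
    have split: "(\<Sum>j\<in>J. a i' j * (y(p := t)) j) = a i' p * t + (\<Sum>j\<in>?J. a i' j * y j)" for i'
    proof -
      have "(\<Sum>j\<in>?J. a i' j * (y(p := t)) j) = (\<Sum>j\<in>?J. a i' j * y j)"
        by (rule sum.cong) auto
      then show ?thesis
        using sum.remove[OF insert.prems(1) p(1), of "\<lambda>j. a i' j * (y(p := t)) j"]
        by (simp del: fun_upd_apply) simp
    qed
    have "(\<Sum>j\<in>J. a i' j * (y(p := t)) j) = 0" if "i' \<in> insert i I" for i'
    proof (cases "i' = i")
      case True
      then show ?thesis unfolding split using p by (simp add: t_def)
    next
      case False
      with that have "i' \<in> I" by simp
      from y(2)[OF this] show ?thesis
        unfolding split
        by (simp add: t_def algebra_simps sum_subtractf sum_distrib_left sum_divide_distrib)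
    qed
    with y(1) show ?thesis
      by (intro exI[of _ "y(p := t)"]) auto
  qed
qed

interpretation opers: vector_space scale_oper
  by (rule vector_space_scale_oper)

text \<open>By Pythagoras, orthogonality on \<open>F\<close> makes the squared norm of f - z over
  \<open>F\<close> the sum of those of f and z; the coordinates outside \<open>F\<close> can only
  add to it.\<close>

lemma ell2_subset_diff_ge:
  assumes F: "finite F" and f: "f \<in> ell2 A" and z: "z \<in> ell2 A"
    and orth: "(\<Sum>g\<in>F. cnj (f g) * z g) = 0"
  shows "(\<Sum>g\<in>F. (cmod (f g))\<^sup>2) \<le> (norm2 (\<lambda>x. f x - z x))\<^sup>2"
proof -
  have "(\<Sum>g\<in>F. (cmod (f g))\<^sup>2) \<le> (\<Sum>g\<in>F. (cmod (f g - z g))\<^sup>2)"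
  proof -
    have "(cmod (f g - z g))\<^sup>2 = (cmod (f g))\<^sup>2 - 2 * Re (cnj (f g) * z g) + (cmod (z g))\<^sup>2" for g
      unfolding cmod_power2 by (simp add: power2_eq_square algebra_simps)
    moreover have "(\<Sum>g\<in>F. Re (cnj (f g) * z g)) = 0"
      using orth by (metis Re_sum zero_complex.sel(1))
    ultimately have "(\<Sum>g\<in>F. (cmod (f g - z g))\<^sup>2) = (\<Sum>g\<in>F. (cmod (f g))\<^sup>2) + (\<Sum>g\<in>F. (cmod (z g))\<^sup>2)"
      by (simp only: sum.distrib sum_subtractf sum_distrib_left[symmetric])
    then show ?thesis
      by (simp add: sum_nonneg)
  qed
  also have "\<dots> \<le> (\<Sum>\<^sub>\<infinity>x. (cmod (f x - z x))\<^sup>2)"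
    by (rule finite_sum_le_infsum[OF ell2_diff_summable[OF f z]]) (use F in auto)
  also have "\<dots> = (norm2 (\<lambda>x. f x - z x))\<^sup>2"
    unfolding norm2_def by (simp add: infsum_nonneg)
  finally show ?thesis .
qed

text \<open>Evaluation at the unit vector of the identity maps a subspace \<open>Z\<close> of dimension less than
  \<open>card F\<close> onto a space of square-summable functions to which some nonzero function supported in
  \<open>F\<close> is orthogonal; the distance from such a function to \<open>Z\<close> is at least its 2-norm.\<close>

lemma (in group) approx_dim_ge_card:
  assumes F: "finite F" "F \<subseteq> carrier G" and "R > 0"
    and Y: "\<And>f. (\<And>g. g \<notin> F \<Longrightarrow> f g = 0) \<Longrightarrow> (\<Sum>g\<in>F. (cmod (f g))\<^sup>2) = R\<^sup>2 \<Longrightarrow> left_reg G f \<in> Y"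
  shows "enat (card F) \<le> approx_dim scale_oper (reduced_norm G) (reduced_algebra G) Y R"
  unfolding approx_dim_def
proof (rule INF_greatest)
  fix Z assume "Z \<in> {Z. Z \<subseteq> reduced_algebra G \<and> (\<exists>B. finite B \<and> Z = opers.span B) \<and>
               (\<forall>y\<in>Y. \<exists>z\<in>Z. reduced_norm G (y - z) < ennreal R)}"
  then obtain B0 where ZX: "Z \<subseteq> reduced_algebra G" and B0: "finite B0" "Z = opers.span B0"
    and approx: "\<And>y. y \<in> Y \<Longrightarrow> \<exists>z\<in>Z. reduced_norm G (y - z) < ennreal R"
    by blast
  \<comment> \<open>The unit vector at the identity: \<open>left_reg G f\<close> sends it to
    \<open>f\<close>, so the operator norm of a difference bounds the 2-norm distance of the values
    there.\<close>
  let ?e = "\<lambda>x. if x = \<one> then 1 else (0::complex)"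
  have e_fin: "?e \<in> fin_supp (carrier G)"
    by (rule fin_suppI[of "{\<one>}"]) auto
  then have e: "?e \<in> ell2 (carrier G)"
    using fin_supp_subset_ell2 by blast
  have "(\<Sum>\<^sub>\<infinity>x. (cmod (?e x))\<^sup>2) = (\<Sum>\<^sub>\<infinity>x\<in>{\<one>}. 1)"
    by (rule infsum_cong_neutral) auto
  then have e1: "norm2 ?e \<le> 1"
    by (simp only: norm2_def) simp
  show "enat (card F) \<le> enat (opers.dim Z)"
  proof (rule ccontr)
    assume "\<not> enat (card F) \<le> enat (opers.dim Z)"
    then have less: "opers.dim Z < card F" by simp
    obtain B where B: "B \<subseteq> Z" "opers.independent B" "Z \<subseteq> opers.span B" "card B = opers.dim Z"
      using opers.basis_exists by blast
    have finB: "finite B"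
      using opers.independent_span_bound[OF B0(1) B(2)] B(1) B0(2) by auto
    \<comment> \<open>One equation per basis element and one unknown per point of \<open>F\<close>,
      hence fewer equations than unknowns.\<close>
    obtain x where x: "\<exists>g\<in>F. x g \<noteq> 0" "\<And>b. b \<in> B \<Longrightarrow> (\<Sum>g\<in>F. b ?e g * x g) = 0"
      using exists_nontrivial_solution[OF finB F(1), of "\<lambda>b. b ?e"] less B(4) by auto
    define s where "s = (\<Sum>g\<in>F. (cmod (x g))\<^sup>2)"
    have s: "s > 0"
      using x(1) F(1) unfolding s_def by (auto intro!: sum_pos2)
    \<comment> \<open>Conjugation turns the bilinear equations for \<open>x\<close> into
      orthogonality to \<open>f\<close>; the factor R / sqrt s gives \<open>f\<close> the 2-norm
      R.\<close>
    define f where "f = (\<lambda>g. if g \<in> F then of_real (R / sqrt s) * cnj (x g) else 0)"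
    have fF: "f g = 0" if "g \<notin> F" for g
      using that by (simp add: f_def)
    have "(\<Sum>g\<in>F. (cmod (f g))\<^sup>2) = (\<Sum>g\<in>F. (R / sqrt s)\<^sup>2 * (cmod (x g))\<^sup>2)"
      by (rule sum.cong) (auto simp: f_def norm_mult power_mult_distrib power_divide norm_divide)
    also have "\<dots> = (R / sqrt s)\<^sup>2 * s"
      by (simp add: s_def sum_distrib_left)
    also have "\<dots> = R\<^sup>2"
      using s by (simp add: power_divide)
    finally have fR: "(\<Sum>g\<in>F. (cmod (f g))\<^sup>2) = R\<^sup>2" .
    have f_fin: "f \<in> fin_supp (carrier G)"
      using F fF by (rule fin_suppI)
    obtain z where z: "z \<in> Z" "reduced_norm G (left_reg G f - z) < ennreal R"
      using approx[OF Y[OF fF fR]] by blast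
    have "(\<Sum>g\<in>F. cnj (f g) * z ?e g) = 0"
    proof -
      \<comment> \<open>The equations hold on the basis and are linear in the operator, so they
        extend to all of \<open>Z\<close>.\<close>
      have "z \<in> opers.span B" using z(1) B(3) by blast
      then have "(\<Sum>g\<in>F. z ?e g * x g) = 0"
      proof (induction rule: opers.span_induct_alt)
        case base
        show ?case by simp
      next
        case (step c b y)
        have "(\<Sum>g\<in>F. (scale_oper c b + y) ?e g * x g)
            = c * (\<Sum>g\<in>F. b ?e g * x g) + (\<Sum>g\<in>F. y ?e g * x g)"
          by (simp add: scale_oper_def sum_distrib_left sum.distrib[symmetric] algebra_simps)
        then show ?case using x(2)[OF step(1)] step(2) by simp
      qed
      moreover have "(\<Sum>g\<in>F. cnj (f g) * z ?e g) = of_real (R / sqrt s) * (\<Sum>g\<in>F. z ?e g * x g)"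
        unfolding sum_distrib_left by (rule sum.cong) (auto simp: f_def)
      ultimately show ?thesis by simp
    qed
    moreover have "z ?e \<in> ell2 (carrier G)"
      using z(1) ZX e by (auto simp: reduced_algebra_def bounded_opers_def)
    moreover have "f \<in> ell2 (carrier G)"
      using f_fin fin_supp_subset_ell2 by blast
    ultimately have "R\<^sup>2 \<le> (norm2 (\<lambda>x. f x - z ?e x))\<^sup>2"
      using ell2_subset_diff_ge[OF F(1), of f "carrier G" "z ?e"] fR by simp
    then have "R \<le> norm2 (\<lambda>x. f x - z ?e x)"
      by (rule power2_le_imp_le) (simp add: norm2_def infsum_nonneg)
    moreover have "(left_reg G f - z) ?e = (\<lambda>x. f x - z ?e x)"
    proof
      fix y
      have "convolution G f ?e y = f y"
      proof (cases "y \<in> carrier G")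
        case True
        have "convolution G f ?e y = (\<Sum>g | f g \<noteq> 0. if g = y then f g else 0)"
          unfolding convolution_def using True
        proof (simp, intro sum.cong refl)
          fix g assume "g \<in> {g. f g \<noteq> 0}"
          then have g: "g \<in> carrier G"
            using f_fin by (auto simp: fin_supp_def)
          have "inv g \<otimes> y = \<one> \<longleftrightarrow> g = y"
            using g True by (metis inv_solve_left l_inv one_closed r_one)
          then show "f g * (if inv g \<otimes> y = \<one> then 1 else 0) = (if g = y then f g else 0)"
            by simp
        qed
        also have "\<dots> = f y"
          using f_fin by (simp add: fin_supp_def sum.delta)
        finally show ?thesis .
      next
        case False
        then show ?thesis
          using f_fin by (auto simp: convolution_def fin_supp_def)
      qed
      then show "(left_reg G f - z) ?e y = f y - z ?e y"
        using e by (simp add: left_reg_def)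
    qed
    ultimately have "ennreal R \<le> ennreal (norm2 ((left_reg G f - z) ?e))"
      by (simp add: ennreal_leI)
    also have "\<dots> \<le> reduced_norm G (left_reg G f - z)"
      unfolding reduced_norm_def by (rule op_norm_ge[OF e e1])
    finally show False
      using z(2) by simp
  qed
qed

section \<open>The metric dimension\<close>

lemma ln_enat_ge:
  assumes "enat m \<le> d" "0 < m"
  shows "ereal (ln (real m)) \<le> ln_enat d"
  using assms by (cases d) (auto simp: ln_enat_def)

text \<open>The upper limit is an infimum, over eventual properties P, of suprema over P; each such
  P meets the frequent set.\<close>

lemma frequently_imp_le_Limsup:
  fixes f :: "'a \<Rightarrow> 'b::complete_linorder"
  assumes "\<exists>\<^sub>F x in F. c \<le> f x"
  shows "c \<le> Limsup F f"
  unfolding Limsup_def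
proof (rule INF_greatest)
  fix P assume "P \<in> {P. eventually P F}"
  then have "\<exists>\<^sub>F x in F. P x \<and> c \<le> f x"
    using assms by (auto intro: frequently_rev_mp eventually_mono)
  then obtain x where "P x" "c \<le> f x"
    by (auto dest: frequently_ex)
  then show "c \<le> (SUP x\<in>Collect P. f x)"
    by (auto intro: SUP_upper2)
qed

text \<open>Any real \<open>a\<close> strictly between 1 and the upper limit works. Exceeding a^n
  for infinitely many n suffices later, because the metric dimension is itself an upper
  limit.\<close>

lemma exponential_growthE:
  assumes "exponential_growth G S"
  obtains a where "a > 1" "\<exists>\<^sub>F n in sequentially. a ^ n < real (growth G S n)"
proof -
  obtain a where a: "1 < ereal a" "ereal a < limsup (\<lambda>n. ereal (root n (real (growth G S n))))"
    using assms ereal_dense2 unfolding exponential_growth_def by blast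
  have "\<exists>\<^sub>F n in sequentially. ereal a < ereal (root n (real (growth G S n)))"
  proof (rule ccontr)
    assume "\<not> ?thesis"
    then have "\<forall>\<^sub>F n in sequentially. ereal (root n (real (growth G S n))) \<le> ereal a"
      by (simp add: not_frequently not_less)
    from Limsup_bounded[OF this] a(2) show False by simp
  qed
  then have "\<exists>\<^sub>F n in sequentially. a ^ n < real (growth G S n)"
  \<comment> \<open>The n-th root is inverted by the n-th power only for n > 0;
    \<open>root 0\<close> is constantly 0.\<close>
  proof (rule frequently_rev_mp, intro eventually_mono[OF eventually_gt_at_top[of 0]] impI)
    fix n :: nat
    assume n: "0 < n" and "ereal a < ereal (root n (real (growth G S n)))"
    then have "a ^ n < root n (real (growth G S n)) ^ n"
      using a(1) by (intro power_strict_mono) auto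
    then show "a ^ n < real (growth G S n)"
      using n by simp
  qed
  then show ?thesis using that a(1) by simp
qed

theorem theorem3p16:
  fixes G :: "('g, 'm) monoid_scheme" and S :: "'g set" and r :: real and k :: nat
  assumes "group G"
    and "finite S" and "S \<subseteq> carrier G" and "generate G S = carrier G"
    and "exponential_growth G S"
    and "r > 0" and "rapid_decay G (word_length G S) r"
    and "real k > r"
  shows "metric_dim scale_oper (reduced_norm G) (reduced_algebra G)
           (length_seminorm G (word_length G S) k) = \<infinity>"
proof -
  interpret generated_group G S
    using assms by (intro generated_group.intro generated_group_axioms.intro)
  let ?l = "word_length G S"
  let ?D = "approx_dim scale_oper (reduced_norm G) (reduced_algebra G)
    {a \<in> reduced_algebra G. length_seminorm G ?l k a < 1}"
  obtain C where C: "C > 0" and RD: "\<And>f. f \<in> fin_supp (carrier G) \<Longrightarrow> reduced_norm G (left_reg G f) \<le>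
         ennreal (C * sqrt (\<Sum>g | f g \<noteq> 0. (cmod (f g))\<^sup>2 * (1 + real (?l g)) powr (2 * r)))"
    using assms(7) unfolding rapid_decay_def by blast
  obtain a where a: "a > 1" "\<exists>\<^sub>F n in sequentially. a ^ n < real (growth G S n)"
    using assms(5) by (rule exponential_growthE)
  define p where "p = real k + r"
  have p: "p > 0" using assms(6) by (simp add: p_def)
  \<comment> \<open>Chosen so that the seminorm bound C (1 + n)^p R_n equals 1/2, strictly below
    1.\<close>
  define R where "R n = 1 / (2 * C * (1 + real n) powr p)" for n :: nat
  have R: "R n > 0" for n
    using C by (simp add: R_def)

  \<comment> \<open>The number \<open>R n\<close> serves both as the radius of the Euclidean sphere
    and as the tolerance of the approximation.\<close>
  have dim: "enat (growth G S n) \<le> ?D (R n)" if "growth G S n > 0" for n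
    unfolding growth_def
  proof (rule approx_dim_ge_card[OF _ _ R])
    let ?B = "{g \<in> carrier G. ?l g \<le> n}"
    \<comment> \<open>An infinite set has \<open>card\<close> 0, so positive growth forces the ball
      to be finite.\<close>
    show fin: "finite ?B"
      using that card_ge_0_finite unfolding growth_def by blast
    show "?B \<subseteq> carrier G" by auto
    fix f :: "'g \<Rightarrow> complex"
    assume f0: "\<And>g. g \<notin> ?B \<Longrightarrow> f g = 0" and fR: "(\<Sum>g\<in>?B. (cmod (f g))\<^sup>2) = (R n)\<^sup>2"
    have f: "f \<in> fin_supp (carrier G)"
      using fin _ f0 by (rule fin_suppI) auto
    have "(\<Sum>g | f g \<noteq> 0. (cmod (f g))\<^sup>2) = (\<Sum>g\<in>?B. (cmod (f g))\<^sup>2)"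
      using fin f0 by (intro sum.mono_neutral_left) auto
    then have "length_seminorm G ?l k (left_reg G f) \<le> ennreal (C * ((1 + real n) powr p * R n))"
      unfolding p_def using f0 fR R[of n] C assms(6)
      by (intro length_seminorm_le[OF f _ _ _ _ _ RD]) force+
    also have "\<dots> = ennreal (1 / 2)"
      using C by (simp add: R_def)
    also have "\<dots> < ennreal 1"
      by (rule ennreal_lessI) auto
    finally have "length_seminorm G ?l k (left_reg G f) < 1"
      by simp
    moreover have "left_reg G f \<in> reduced_algebra G"
      using RD[OF f] by (intro left_reg_reduced_algebra[OF f]) (auto intro: le_less_trans)
    ultimately show "left_reg G f \<in> {a \<in> reduced_algebra G. length_seminorm G ?l k a < 1}"
      by simp
  qed

  have "ereal M \<le> metric_dim scale_oper (reduced_norm G) (reduced_algebra G)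
           (length_seminorm G ?l k)" for M
    unfolding metric_dim_def
  proof (rule frequently_imp_le_Limsup)
    let ?q = "\<lambda>\<delta>. ln_enat (?D \<delta>) / ereal (ln (1 / \<delta>))"
    have lim: "filterlim R (at_right 0) sequentially"
      unfolding R_def using C p by real_asymp
    have "ln a > 0" using a(1) by simp
    \<comment> \<open>The denominator ln (1 / R_n) = ln (2C) + p ln (1 + n) grows only
      logarithmically, the numerator linearly.\<close>
    then have "filterlim (\<lambda>n. real n * ln a / ln (1 / R n)) at_top sequentially"
      unfolding R_def using C p by real_asymp
    then have "\<forall>\<^sub>F n in sequentially. M \<le> real n * ln a / ln (1 / R n)"
      by (simp add: filterlim_at_top)
    \<comment> \<open>This makes ln (1 / R_n) positive, so dividing by it preserves
      inequalities.\<close>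
    moreover have "\<forall>\<^sub>F n in sequentially. R n < 1"
      unfolding R_def using C p by real_asymp
    ultimately have "\<forall>\<^sub>F n in sequentially. a ^ n < real (growth G S n) \<longrightarrow> ereal M \<le> ?q (R n)"
    proof (eventually_elim, intro impI)
      fix n assume M: "M \<le> real n * ln a / ln (1 / R n)" and "R n < 1"
        and an: "a ^ n < real (growth G S n)"
      then have ln: "ln (1 / R n) > 0"
        using R[of n] by simp
      have "0 < a ^ n" using a(1) by simp
      then have pos: "growth G S n > 0"
        using an by (metis less_trans of_nat_0_less_iff)
      have "real n * ln a = ln (a ^ n)"
        using a(1) by (simp add: ln_realpow)
      also have "\<dots> \<le> ln (real (growth G S n))"
        using an \<open>0 < a ^ n\<close> by simp
      finally have "ereal (real n * ln a) \<le> ln_enat (?D (R n))"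
        using ln_enat_ge[OF dim[OF pos] pos] by (meson ereal_less_eq(3) order_trans)
      then have "ereal (real n * ln a) / ereal (ln (1 / R n)) \<le> ?q (R n)"
        using ln by (intro ereal_divide_right_mono) auto
      moreover have "ereal M \<le> ereal (real n * ln a) / ereal (ln (1 / R n))"
        using M ln by simp
      ultimately show "ereal M \<le> ?q (R n)" by (rule order_trans[rotated])
    qed
    then have "\<exists>\<^sub>F n in sequentially. ereal M \<le> ?q (R n)"
      by (rule frequently_mp[OF _ a(2)])
    \<comment> \<open>Since R_n tends to 0 from the right, what holds for infinitely many n holds
      for arbitrarily small \<delta> > 0.\<close>
    then have "\<exists>\<^sub>F \<delta> in filtermap R sequentially. ereal M \<le> ?q \<delta>"
      by (simp add: frequently_def eventually_filtermap)
    then show "\<exists>\<^sub>F \<delta> in at_right 0. ereal M \<le> ?q \<delta>"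
      using lim unfolding filterlim_def frequently_def by (auto dest: filter_leD)
  qed
  then show ?thesis
    by (rule ereal_top)
qed

end
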